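(* Let $n\geq 1$ and let ${\cal E}_n:=\mathrm{conv}\{e(G): G \text{ a simple graph on vertex set } [n]\}\subset\mathbb{R}^n$ be the degree enumerator polytope of the complete graph $K_n$. The vertices of ${\cal E}_n$ are as follows. \begin{itemize} \item If $n$ is even, they are $e_n(r):=n\cdot{\bf 1}_r=e(G_n(r))$ for $0\leq r\leq n-1$. \item If $n$ is odd, they are: (1) $e_n(r)=n\cdot{\bf 1}_r=e(G_n(r))$ for even $0\leq r\leq n-1$; and (2) $e_n(r,s):=(n-1)\cdot{\bf 1}_r+{\bf 1}_s=e(G_n(r,s))$ for odd $0<r<n-1$ and even $0\leq s\leq n-1$. \end{itemize} The number of vertices is $n$ for even $n$ and $\left(\frac{n+1}{2}\right)^2$ for odd $n$.
   Context: Notation: $[n]:=\{0,1,\dots,n-1\}$. Vectors in $\mathbb{R}^n$ are indexed $x=(x_0,\dots,x_{n-1})$, and ${\bf 1}_i$ ($i=0,\dots,n-1$) denotes the $i$-th unit vector. For a simple graph $G$ on vertex set $[n]$, $d_v(G)$ is the degree of vertex $v$, and the degree enumerator of $G$ is $e(G)=(e_0(G),\dots,e_{n-1}(G))$ where $e_i(G)$ is the number of vertices of $G$ of degree $i$. The graphs $G_n(r)$ and $G_n(r,s)$ on vertex set $[n]$: For any $n\geq1$ and even $0\leq r\leq n-1$, $G_n(r)$ has edge set $E_n(r):=\{\{i,(i+j)\bmod n\}: i=0,\dots,n-1,\ j=1,\dots,r/2\}$ (each vertex on a circle joined to the $r/2$ nearest vertices on each side); it is $r$-regular. For even $n$ and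 odd $1\leq r\leq n-1$, $E_n(r):=E_n(r-1)\uplus M_n$ where $M_n:=\{\{i,n/2+i\}: i=0,\dots,n/2-1\}$ is a perfect matching; $G_n(r)$ is $r$-regular. For odd $n$, odd $0<r<n-1$ and even $0\leq s\leq n-1$, $G_n(r,s)$ has edge set $E_n(r,s):=E_{n-1}(r)$ if $s=0$, and if $s\geq2$, $E_n(r,s):=\big(E_{n-1}(r)\setminus\{\{i,\tfrac{n-1}{2}+i\}: i=0,\dots,\tfrac s2-1\}\big)\uplus\{\{i,n-1\}: i=0,\dots,\tfrac s2-1\}\uplus\{\{\tfrac{n-1}{2}+i,n-1\}: i=0,\dots,\tfrac s2-1\}$; so vertex $n-1$ has degree $s$ and all other vertices have degree $r$. *)

theory Defs
  imports "HOL-Analysis.Analysis"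
begin

text \<open>
  A simple graph on the vertex set \<open>{..<n}\<close> is represented by its edge set.
\<close>

definition simple_graph :: "nat \<Rightarrow> nat set set \<Rightarrow> bool" where
  "simple_graph n E \<longleftrightarrow> (\<forall>e\<in>E. e \<subseteq> {..<n} \<and> card e = 2)"

definition vertex_degree :: "nat set set \<Rightarrow> nat \<Rightarrow> nat" where
  "vertex_degree E v = card {e \<in> E. v \<in> e}"

definition num_of_degree :: "nat \<Rightarrow> nat set set \<Rightarrow> nat \<Rightarrow> nat" where
  "num_of_degree n E i = card {v \<in> {..<n}. vertex_degree E v = i}"

text \<open>
  The space of \<open>n\<close>-dimensional real vectors is \<open>real ^ 'n\<close> with \<open>CARD('n) = n\<close>.  Since \<open>'n\<close> is an
  abstract index type, its elements are numbered by a map \<open>ix\<close>, which is a bijection from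
  \<open>{..<n}\<close> onto \<open>'n\<close> wherever it is used: \<open>x $ ix i\<close> is the coordinate \<open>i\<close> of \<open>x\<close>.
\<close>

definition unit_vec :: "(nat \<Rightarrow> 'n::finite) \<Rightarrow> nat \<Rightarrow> real ^ 'n" where
  "unit_vec ix i = axis (ix i) 1"

definition degree_enumerator :: "nat \<Rightarrow> (nat \<Rightarrow> 'n::finite) \<Rightarrow> nat set set \<Rightarrow> real ^ 'n" where
  "degree_enumerator n ix E = (\<Sum>i<n. real (num_of_degree n E i) *\<^sub>R unit_vec ix i)"

definition degree_enumerator_polytope :: "nat \<Rightarrow> (nat \<Rightarrow> 'n::finite) \<Rightarrow> (real ^ 'n) set" where
  "degree_enumerator_polytope n ix =
     convex hull {degree_enumerator n ix E | E. simple_graph n E}"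

definition polytope_vertices :: "'a::real_vector set \<Rightarrow> 'a set" where
  "polytope_vertices P = {x. x extreme_point_of P}"

definition circular_edges :: "nat \<Rightarrow> nat \<Rightarrow> nat set set" where
  "circular_edges n r = {{i, (i + j) mod n} | i j. i < n \<and> 1 \<le> j \<and> j \<le> r div 2}"

definition antipodal_matching :: "nat \<Rightarrow> nat set set" where
  "antipodal_matching n = {{i, n div 2 + i} | i. i < n div 2}"

text \<open>
  The edge sets of the graphs \<open>G\<^sub>n(r)\<close> and \<open>G\<^sub>n(r,s)\<close>.  The former is meaningful for
  \<open>r \<le> n - 1\<close> with \<open>n\<close> or \<open>r\<close> even, the latter for odd \<open>n\<close>, odd \<open>r < n - 1\<close> and even
  \<open>s \<le> n - 1\<close>; outside these ranges the values are irrelevant.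
\<close>

definition regular_edges :: "nat \<Rightarrow> nat \<Rightarrow> nat set set" where
  "regular_edges n r =
     (if even r then circular_edges n r
      else circular_edges n (r - 1) \<union> antipodal_matching n)"

definition near_regular_edges :: "nat \<Rightarrow> nat \<Rightarrow> nat \<Rightarrow> nat set set" where
  "near_regular_edges n r s =
     (if s = 0 then regular_edges (n - 1) r
      else (regular_edges (n - 1) r - {{i, (n - 1) div 2 + i} | i. i < s div 2})
           \<union> {{i, n - 1} | i. i < s div 2}
           \<union> {{(n - 1) div 2 + i, n - 1} | i. i < s div 2})"

definition regular_vec :: "nat \<Rightarrow> (nat \<Rightarrow> 'n::finite) \<Rightarrow> nat \<Rightarrow> real ^ 'n" where
  "regular_vec n ix r = real n *\<^sub>R unit_vec ix r"

definition near_regular_vec :: "nat \<Rightarrow> (nat \<Rightarrow> 'n::finite) \<Rightarrow> nat \<Rightarrow> nat \<Rightarrow> real ^ 'n" where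
  "near_regular_vec n ix r s = real (n - 1) *\<^sub>R unit_vec ix r + unit_vec ix s"

end

theory Submission imports Defs begin

text \<open>
  The coordinates of a degree enumerator are nonnegative with sum \<open>n\<close>, and by the handshake lemma
  the coordinates of odd index sum to at most \<open>n - 1\<close> if \<open>n\<close> is odd.  Every vector with these
  properties is a convex combination of the vectors in the theorem, which are enumerators of
  circulant-like graphs.  Each of these is the unique maximizer over the polytope of a linear
  functional: \<open>x\<^sub>r\<close> for \<open>e\<^sub>n(r)\<close>, and \<open>2 x\<^sub>r + x\<^sub>s\<close> for \<open>e\<^sub>n(r,s)\<close>.
\<close>

section \<open>Degrees in circulant graphs\<close>

text \<open>Every edge has two elements, so \<open>w\<close> maps to \<open>{v, w}\<close>
  bijectively from neighbours to incident edges. Degrees of the constructed graphs are then counted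
  through neighbour sets.\<close>

lemma vertex_degree_eq_card_neighbours:
  assumes "simple_graph n E"
  shows "vertex_degree E v = card {w. {v, w} \<in> E}"
proof -
  have "bij_betw (\<lambda>w. {v, w}) {w. {v, w} \<in> E} {e \<in> E. v \<in> e}"
  proof (rule bij_betw_imageI)
    show "inj_on (\<lambda>w. {v, w}) {w. {v, w} \<in> E}"
      by (auto simp: inj_on_def doubleton_eq_iff)
    show "(\<lambda>w. {v, w}) ` {w. {v, w} \<in> E} = {e \<in> E. v \<in> e}"
    proof (intro equalityI subsetI)
      fix e assume e: "e \<in> {e \<in> E. v \<in> e}"
      then have "card e = 2" using assms by (auto simp: simple_graph_def)
      then obtain w where "e = {v, w}"
        using e by (auto simp: card_2_iff insert_commute)
      with e show "e \<in> (\<lambda>w. {v, w}) ` {w. {v, w} \<in> E}" by simp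
    qed auto
  qed
  from bij_betw_same_card[OF this] show ?thesis
    by (simp add: vertex_degree_def)
qed

lemma add_mod_eq_if:
  fixes a b n :: nat
  assumes "a < n" "b < n"
  shows "(a + b) mod n = (if a + b < n then a + b else a + b - n)"
  using assms by (simp add: mod_if)

lemma inj_on_add_mod:
  fixes v n :: nat
  assumes "v < n"
  shows "inj_on (\<lambda>j. (v + j) mod n) {..<n}"
proof (rule inj_onI)
  fix i j assume "i \<in> {..<n}" "j \<in> {..<n}" and "(v + i) mod n = (v + j) mod n"
  then show "i = j"
    using assms add_mod_eq_if[of v n i] add_mod_eq_if[of v n j] by (simp split: if_splits)
qed

text \<open>On the circle, a step of \<open>j\<close> from \<open>w\<close> to \<open>v\<close> is
  undone by a step of \<open>n - j\<close> from \<open>v\<close>. This turns undirected edges into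
  offsets measured from one fixed endpoint.\<close>

lemma eq_add_mod_iff:
  fixes v w j n :: nat
  assumes "v < n" "w < n" "1 \<le> j" "j < n"
  shows "v = (w + j) mod n \<longleftrightarrow> w = (v + (n - j)) mod n"
  using assms add_mod_eq_if[of w n j] add_mod_eq_if[of v n "n - j"] by (simp split: if_splits) linarith+

text \<open>The connection set of the circulant graph: the second interval holds the negatives
  modulo \<open>n\<close> of the first, and for even \<open>n\<close> the half turn
  \<open>n div 2\<close> is its own negative.\<close>

definition offsets :: "nat \<Rightarrow> nat \<Rightarrow> nat set" where
  "offsets n r = {1..r div 2} \<union> {n - r div 2..<n} \<union> (if odd r then {n div 2} else {})"

lemma offsets_subset:
  assumes "r < n"
  shows "offsets n r \<subseteq> {1..<n}"
proof -
  have "1 \<le> n div 2" if "odd r"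
    using that assms by (cases r) auto
  then show ?thesis using assms by (auto simp: offsets_def)
qed

text \<open>Since \<open>2 * (r div 2) \<le> r < n\<close>, the two intervals do not meet; for odd
  \<open>r\<close> and even \<open>n\<close> the half turn lies strictly between them and adds
  one.\<close>

lemma card_offsets:
  assumes "r < n" "even n \<or> even r"
  shows "card (offsets n r) = r"
proof -
  have disj: "{1..r div 2} \<inter> {n - r div 2..<n} = {}" using assms by auto
  have c: "card ({1..r div 2} \<union> {n - r div 2..<n}) = 2 * (r div 2)"
    using assms by (subst card_Un_disjoint[OF _ _ disj]) auto
  show ?thesis
  proof (cases "even r")
    case True
    then show ?thesis using c by (simp add: offsets_def)
  next
    case False
    then have "even n" using assms by simp
    then have "n div 2 \<notin> {1..r div 2} \<union> {n - r div 2..<n}"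
      using assms False by (auto elim!: evenE)
    moreover have "Suc (2 * (r div 2)) = r" using False by simp
    ultimately show ?thesis using False c by (simp add: offsets_def)
  qed
qed

text \<open>The vertex \<open>v\<close> may be the start or the end of the step that generates the
  edge; the second case is a step by \<open>n - j\<close> from \<open>v\<close>.\<close>

lemma circular_edges_iff:
  assumes "r < n" "v < n"
  shows "{v, w} \<in> circular_edges n r \<longleftrightarrow>
    (\<exists>j \<in> {1..r div 2} \<union> {n - r div 2..<n}. w = (v + j) mod n)"
proof -
  have "{v, w} \<in> circular_edges n r \<longleftrightarrow>
      (\<exists>j. 1 \<le> j \<and> j \<le> r div 2 \<and> (w = (v + j) mod n \<or> w < n \<and> v = (w + j) mod n))"
    using assms by (auto simp: circular_edges_def doubleton_eq_iff)
  also have "\<dots> \<longleftrightarrow>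
      (\<exists>j. 1 \<le> j \<and> j \<le> r div 2 \<and> (w = (v + j) mod n \<or> w = (v + (n - j)) mod n))"
  proof -
    have "w < n \<and> v = (w + j) mod n \<longleftrightarrow> w = (v + (n - j)) mod n"
      if "1 \<le> j" "j \<le> r div 2" for j
    proof (cases "w < n")
      case True
      have "j < n" using that assms by linarith
      then show ?thesis using eq_add_mod_iff[of v n w j] True assms that by simp
    qed (use assms in auto)
    then show ?thesis by metis
  qed
  also have "\<dots> \<longleftrightarrow> (\<exists>j \<in> {1..r div 2} \<union> {n - r div 2..<n}. w = (v + j) mod n)"
  proof
    assume "\<exists>j. 1 \<le> j \<and> j \<le> r div 2 \<and> (w = (v + j) mod n \<or> w = (v + (n - j)) mod n)"
    then obtain j where j: "1 \<le> j" "j \<le> r div 2"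
      and "w = (v + j) mod n \<or> w = (v + (n - j)) mod n" by blast
    moreover have "j \<in> {1..r div 2}" "n - j \<in> {n - r div 2..<n}" using j assms by auto
    ultimately show "\<exists>j \<in> {1..r div 2} \<union> {n - r div 2..<n}. w = (v + j) mod n" by blast
  next
    assume "\<exists>j \<in> {1..r div 2} \<union> {n - r div 2..<n}. w = (v + j) mod n"
    then obtain j where j: "j \<in> {1..r div 2} \<or> j \<in> {n - r div 2..<n}"
      and w: "w = (v + j) mod n" by blast
    from j show "\<exists>j. 1 \<le> j \<and> j \<le> r div 2 \<and> (w = (v + j) mod n \<or> w = (v + (n - j)) mod n)"
    proof
      assume "j \<in> {1..r div 2}"
      with w show ?thesis by auto
    next
      assume "j \<in> {n - r div 2..<n}"
      then have "1 \<le> n - j \<and> n - j \<le> r div 2 \<and> n - (n - j) = j" using assms by auto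
      with w show ?thesis by metis
    qed
  qed
  finally show ?thesis .
qed

lemma antipodal_matching_iff:
  assumes "even n" "v < n"
  shows "{v, w} \<in> antipodal_matching n \<longleftrightarrow> w = (v + n div 2) mod n"
proof -
  have "{v, w} \<in> antipodal_matching n \<longleftrightarrow>
      v < n div 2 \<and> w = v + n div 2 \<or> w < n div 2 \<and> v = w + n div 2"
    by (auto simp: antipodal_matching_def doubleton_eq_iff)
  then show ?thesis using assms by (auto simp: add_mod_eq_if elim!: evenE)
qed

lemma regular_edges_iff:
  assumes "r < n" "even n \<or> even r" "v < n"
  shows "{v, w} \<in> regular_edges n r \<longleftrightarrow> (\<exists>j \<in> offsets n r. w = (v + j) mod n)"
proof (cases "even r")
  case True
  then show ?thesis
    using assms by (simp add: regular_edges_def offsets_def circular_edges_iff)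
next
  case False
  then have "(r - 1) div 2 = r div 2" by (auto elim: oddE)
  then show ?thesis
    using assms False circular_edges_iff[of "r - 1" n v w] antipodal_matching_iff[of n v w]
    by (auto simp: regular_edges_def offsets_def)
qed

text \<open>One endpoint is below \<open>n\<close> by construction. The other is reached from it by
  an offset in \<open>{1..<n}\<close>, so it is also below \<open>n\<close> and is a different
  vertex.\<close>

lemma simple_graph_regular_edges:
  assumes "r < n" "even n \<or> even r"
  shows "simple_graph n (regular_edges n r)"
  unfolding simple_graph_def
proof
  fix e assume e: "e \<in> regular_edges n r"
  have "\<exists>v w. e = {v, w} \<and> v < n"
  proof (cases "e \<in> antipodal_matching n")
    case True
    then show ?thesis by (force simp: antipodal_matching_def)
  next
    case False
    then have "e \<in> circular_edges n r \<or> e \<in> circular_edges n (r - 1)"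
      using e by (auto simp: regular_edges_def split: if_splits)
    then show ?thesis by (auto simp: circular_edges_def)
  qed
  then obtain v w where vw: "e = {v, w}" "v < n" by blast
  then obtain j where j: "j \<in> offsets n r" "w = (v + j) mod n"
    using e regular_edges_iff[OF assms vw(2)] by blast
  then have "1 \<le> j" "j < n" using offsets_subset[OF assms(1)] by auto
  then have "w < n" "w \<noteq> v" using j vw by (auto simp: add_mod_eq_if split: if_splits)
  then show "e \<subseteq> {..<n} \<and> card e = 2" using vw by auto
qed

lemma neighbours_regular_edges:
  assumes "r < n" "even n \<or> even r" "v < n"
  shows "{w. {v, w} \<in> regular_edges n r} = (\<lambda>j. (v + j) mod n) ` offsets n r"
  using regular_edges_iff[OF assms] by auto

lemma card_neighbours_regular_edges:
  assumes "r < n" "even n \<or> even r" "v < n"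
  shows "card {w. {v, w} \<in> regular_edges n r} = r"
proof -
  have "inj_on (\<lambda>j. (v + j) mod n) (offsets n r)"
    by (rule inj_on_subset[OF inj_on_add_mod[OF assms(3)]])
      (use offsets_subset[OF assms(1)] in auto)
  then show ?thesis
    using assms by (simp add: neighbours_regular_edges card_image card_offsets)
qed

lemma vertex_degree_regular_edges:
  assumes "r < n" "even n \<or> even r" "v < n"
  shows "vertex_degree (regular_edges n r) v = r"
  using vertex_degree_eq_card_neighbours[OF simple_graph_regular_edges[OF assms(1,2)]]
    card_neighbours_regular_edges[OF assms] by simp

section \<open>Rewiring a regular graph at one additional vertex\<close>

text \<open>The endpoints of the removed matching edges, which are at the same time the neighbours
  given to the new vertex \<open>n - 1\<close>.\<close>

definition touched :: "nat \<Rightarrow> nat \<Rightarrow> nat set" where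
  "touched n s = {..<s div 2} \<union> (\<lambda>i. (n - 1) div 2 + i) ` {..<s div 2}"

lemma card_touched:
  assumes "even s" "s \<le> n - 1"
  shows "card (touched n s) = s"
proof -
  have "card (touched n s) = s div 2 + s div 2"
    unfolding touched_def using assms
    by (subst card_Un_disjoint) (auto simp: card_image)
  then show ?thesis using assms by auto
qed

lemma touched_subset:
  assumes "odd n" "s \<le> n - 1"
  shows "touched n s \<subseteq> {..<n - 1}"
  using assms by (auto simp: touched_def elim!: oddE)

text \<open>For \<open>s = 0\<close> both the removed and the added edges form empty families, so
  one formula covers both cases of the definition.\<close>

lemma near_regular_edges_eq:
  "near_regular_edges n r s =
     (regular_edges (n - 1) r - {{i, (n - 1) div 2 + i} | i. i < s div 2})
       \<union> (\<lambda>i. {i, n - 1}) ` touched n s"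
  by (auto simp: near_regular_edges_def touched_def)

text \<open>The antipode of a touched vertex is touched, so a removed edge is recognised from either
  endpoint: it joins a touched vertex to its antipode.\<close>

lemma deleted_edge_iff:
  assumes "odd n" "s \<le> n - 1" "v < n - 1"
  shows "{v, w} \<in> {{i, (n - 1) div 2 + i} | i. i < s div 2} \<longleftrightarrow>
    v \<in> touched n s \<and> w = (v + (n - 1) div 2) mod (n - 1)"
proof -
  have "{v, w} \<in> {{i, (n - 1) div 2 + i} | i. i < s div 2} \<longleftrightarrow>
      v < s div 2 \<and> w = v + (n - 1) div 2 \<or> w < s div 2 \<and> v = w + (n - 1) div 2"
    by (auto simp: doubleton_eq_iff)
  also have "\<dots> \<longleftrightarrow> v \<in> touched n s \<and> w = (v + (n - 1) div 2) mod (n - 1)"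
  proof -
    obtain h where h: "n = 2 * h + 1" using assms(1) by (auto elim: oddE)
    have t: "v \<in> touched n s \<longleftrightarrow> v < s div 2 \<or> h \<le> v \<and> v - h < s div 2"
    proof -
      have "v \<in> (\<lambda>i. h + i) ` {..<s div 2} \<longleftrightarrow> h \<le> v \<and> v - h < s div 2"
        by (auto simp: le_iff_add)
      then show ?thesis by (simp add: touched_def h)
    qed
    have v: "v < 2 * h" and k: "s div 2 \<le> h" using assms(2,3) h by auto
    \<comment> \<open>The circle has \<open>n - 1 = 2 * h\<close> vertices, and adding
      \<open>h\<close> swaps its two halves.\<close>
    then have mate: "(v + h) mod (2 * h) = (if v < h then v + h else v - h)"
      using add_mod_eq_if[of v "2 * h" h] by (cases "v < h") simp_all
    have "v < s div 2 \<and> w = v + h \<or> w < s div 2 \<and> v = w + h \<longleftrightarrow>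
        (v < s div 2 \<or> h \<le> v \<and> v - h < s div 2) \<and> w = (if v < h then v + h else v - h)"
      using k by (cases "v < h") auto
    then show ?thesis unfolding t using mate by (simp add: h)
  qed
  finally show ?thesis .
qed

context
  fixes n r s :: nat
  assumes n: "odd n" and r: "odd r" "r < n - 1" and s: "even s" "s \<le> n - 1"
begin

lemma simple_graph_near_regular_edges: "simple_graph n (near_regular_edges n r s)"
  unfolding simple_graph_def
proof
  fix e assume "e \<in> near_regular_edges n r s"
  then consider "e \<in> regular_edges (n - 1) r" | i where "i \<in> touched n s" "e = {i, n - 1}"
    by (auto simp only: near_regular_edges_eq)
  then show "e \<subseteq> {..<n} \<and> card e = 2"
  proof cases
    case 1
    have "simple_graph (n - 1) (regular_edges (n - 1) r)"
      by (rule simple_graph_regular_edges) (use n r in simp_all)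
    with 1 have "e \<subseteq> {..<n - 1}" "card e = 2" by (simp_all add: simple_graph_def)
    moreover have "{..<n - 1} \<subseteq> {..<n}" by simp
    ultimately show ?thesis by (meson subset_trans)
  next
    case 2
    then have "i < n - 1" using touched_subset[OF n s(2)] by auto
    then show ?thesis using 2(2) by auto
  qed
qed

lemma vertex_degree_near_regular_edges_last:
  "vertex_degree (near_regular_edges n r s) (n - 1) = s"
proof -
  have sg: "simple_graph (n - 1) (regular_edges (n - 1) r)"
    by (rule simple_graph_regular_edges) (use n r in simp_all)
  have "{n - 1, w} \<in> near_regular_edges n r s \<longleftrightarrow> w \<in> touched n s" for w
  proof -
    have "{n - 1, w} \<notin> regular_edges (n - 1) r"
      using sg by (auto simp: simple_graph_def)
    moreover have "{n - 1, w} \<in> (\<lambda>i. {i, n - 1}) ` touched n s \<longleftrightarrow> w \<in> touched n s"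
    proof
      assume "{n - 1, w} \<in> (\<lambda>i. {i, n - 1}) ` touched n s"
      then obtain i where "i \<in> touched n s" "{n - 1, w} = {i, n - 1}" by blast
      then show "w \<in> touched n s" by (simp add: doubleton_eq_iff) blast
    next
      assume "w \<in> touched n s"
      then show "{n - 1, w} \<in> (\<lambda>i. {i, n - 1}) ` touched n s"
        by (subst insert_commute) (rule imageI)
    qed
    ultimately show ?thesis by (simp only: near_regular_edges_eq Un_iff Diff_iff) simp
  qed
  then show ?thesis
    using vertex_degree_eq_card_neighbours[OF simple_graph_near_regular_edges]
      card_touched[OF s] by simp
qed

text \<open>A touched vertex trades its antipode for the new vertex \<open>n - 1\<close>, and an
  untouched one keeps its neighbours, so the degree stays \<open>r\<close>.\<close>

lemma vertex_degree_near_regular_edges: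
  assumes v: "v < n - 1"
  shows "vertex_degree (near_regular_edges n r s) v = r"
proof -
  let ?N = "{w. {v, w} \<in> regular_edges (n - 1) r}"
  let ?m = "(v + (n - 1) div 2) mod (n - 1)"
  have ev: "even (n - 1)" using n by simp
  have sg: "simple_graph (n - 1) (regular_edges (n - 1) r)"
    by (rule simple_graph_regular_edges) (use n r in auto)
  have N: "?N \<subseteq> {..<n - 1}" using sg by (auto simp: simple_graph_def)
  then have fin: "finite ?N" by (rule finite_subset) simp
  have card_N: "card ?N = r"
    using card_neighbours_regular_edges[of r "n - 1" v] r v ev by simp
  \<comment> \<open>The oddness of \<open>r\<close> enters here: the half turn is an offset, so the
    edge to be removed is really present.\<close>
  have m: "?m \<in> ?N"
    using regular_edges_iff[of r "n - 1" v ?m] r v ev by (auto simp: offsets_def)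
  have iff: "{v, w} \<in> near_regular_edges n r s \<longleftrightarrow>
      w \<in> ?N \<and> \<not> (v \<in> touched n s \<and> w = ?m) \<or> v \<in> touched n s \<and> w = n - 1" for w
  proof -
    have "{v, w} \<in> (\<lambda>i. {i, n - 1}) ` touched n s \<longleftrightarrow> v \<in> touched n s \<and> w = n - 1"
      using v by (auto simp: doubleton_eq_iff)
    then show ?thesis
      unfolding near_regular_edges_eq using deleted_edge_iff[OF n s(2) v, of w] by auto
  qed
  have "card {w. {v, w} \<in> near_regular_edges n r s} = r"
  proof (cases "v \<in> touched n s")
    case True
    then have "{w. {v, w} \<in> near_regular_edges n r s} = insert (n - 1) (?N - {?m})"
      using iff by auto
    moreover have "n - 1 \<notin> ?N - {?m}" using N by auto
    ultimately have "card {w. {v, w} \<in> near_regular_edges n r s} = Suc (card (?N - {?m}))"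
      using fin by simp
    also have "\<dots> = card ?N" using fin m by (rule card.remove[symmetric])
    finally show ?thesis using card_N by simp
  next
    case False
    then have "{w. {v, w} \<in> near_regular_edges n r s} = ?N" using iff by auto
    then show ?thesis using card_N by simp
  qed
  then show ?thesis
    using vertex_degree_eq_card_neighbours[OF simple_graph_near_regular_edges] by simp
qed

end

section \<open>Degree sums\<close>

lemma finite_simple_graph: "simple_graph n E \<Longrightarrow> finite E"
  by (rule finite_subset[of _ "Pow {..<n}"]) (auto simp: simple_graph_def)

text \<open>No vertex is its own neighbour. Hence every degree is one of the \<open>n\<close>
  coordinate indices and the enumerator misses no vertex.\<close>

lemma vertex_degree_less:
  assumes "simple_graph n E" "v < n"
  shows "vertex_degree E v < n"
proof -
  have "{w. {v, w} \<in> E} \<subseteq> {..<n} - {v}"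
    using assms(1) by (fastforce simp: simple_graph_def)
  then have "card {w. {v, w} \<in> E} \<le> card ({..<n} - {v})" by (intro card_mono) auto
  then show ?thesis
    using vertex_degree_eq_card_neighbours[OF assms(1)] assms(2) by simp
qed

text \<open>The handshake lemma, by double counting incident pairs of a vertex and an edge.\<close>

lemma even_sum_vertex_degree:
  assumes "simple_graph n E"
  shows "even (\<Sum>v<n. vertex_degree E v)"
proof -
  have "(\<Sum>v<n. card {e \<in> E. v \<in> e}) = 2 * card E"
  proof (rule sum_multicount)
    show "\<forall>e\<in>E. card {v \<in> {..<n}. v \<in> e} = 2"
    proof
      fix e assume "e \<in> E"
      then have "{v \<in> {..<n}. v \<in> e} = e" "card e = 2"
        using assms by (auto simp: simple_graph_def)
      then show "card {v \<in> {..<n}. v \<in> e} = 2" by simp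
    qed
  qed (use finite_simple_graph[OF assms] in auto)
  then show ?thesis by (simp add: vertex_degree_def)
qed

lemma sum_num_of_degree_eq_card:
  assumes "simple_graph n E"
  shows "(\<Sum>i | i < n \<and> P i. num_of_degree n E i) = card {v \<in> {..<n}. P (vertex_degree E v)}"
proof -
  have "(\<Sum>i | i < n \<and> P i. num_of_degree n E i)
      = card (\<Union>i\<in>{i. i < n \<and> P i}. {v \<in> {..<n}. vertex_degree E v = i})"
    unfolding num_of_degree_def by (rule card_UN_disjoint[symmetric]) auto
  also have "(\<Union>i\<in>{i. i < n \<and> P i}. {v \<in> {..<n}. vertex_degree E v = i})
      = {v \<in> {..<n}. P (vertex_degree E v)}"
    using vertex_degree_less[OF assms] by auto
  finally show ?thesis .
qed

lemma sum_num_of_degree: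
  assumes "simple_graph n E"
  shows "(\<Sum>i<n. num_of_degree n E i) = n"
  using sum_num_of_degree_eq_card[OF assms, of "\<lambda>_. True"] by (simp add: lessThan_def)

text \<open>If all of an odd number of vertices had odd degree, the degree sum would be odd, against
  the handshake lemma.\<close>

lemma sum_num_of_odd_degree_less:
  assumes "simple_graph n E" "odd n"
  shows "(\<Sum>i | i < n \<and> odd i. num_of_degree n E i) < n"
proof -
  have "{v \<in> {..<n}. odd (vertex_degree E v)} \<noteq> {..<n}"
  proof
    assume "{v \<in> {..<n}. odd (vertex_degree E v)} = {..<n}"
    then have "even (\<Sum>v<n. vertex_degree E v) \<longleftrightarrow> even n"
      by (simp add: even_sum_iff)
    with assms even_sum_vertex_degree show False by blast
  qed
  then have "card {v \<in> {..<n}. odd (vertex_degree E v)} < card {..<n}"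
    by (intro psubset_card_mono) auto
  then show ?thesis using sum_num_of_degree_eq_card[OF assms(1)] by simp
qed

section \<open>Convex combinations of unit vectors\<close>

text \<open>The affine map \<open>x\<close> to \<open>a x + b\<close> commutes with convex
  combinations because the weights sum to 1. This permits averaging over one index while everything
  else is held fixed.\<close>

lemma scaled_sum_in_convex:
  fixes e :: "'i \<Rightarrow> 'a::real_vector" and c :: "'i \<Rightarrow> real"
  assumes "convex C" "finite I" "\<And>i. i \<in> I \<Longrightarrow> 0 \<le> c i" "sum c I = 1"
    and "\<And>i. i \<in> I \<Longrightarrow> a *\<^sub>R e i + b \<in> C"
  shows "a *\<^sub>R (\<Sum>i\<in>I. c i *\<^sub>R e i) + b \<in> C"
proof -
  have "(\<Sum>i\<in>I. c i *\<^sub>R (a *\<^sub>R e i + b)) \<in> C"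
    using assms by (intro convex_sum) auto
  also have "(\<Sum>i\<in>I. c i *\<^sub>R (a *\<^sub>R e i + b))
      = a *\<^sub>R (\<Sum>i\<in>I. c i *\<^sub>R e i) + sum c I *\<^sub>R b"
    by (simp add: scaleR_add_right sum.distrib scaleR_right.sum scaleR_sum_left mult.commute)
  finally show ?thesis using assms(4) by simp
qed

text \<open>Writing the sum as \<open>a p + (m - a) q\<close> with \<open>p\<close> and \<open>q\<close> the normalised partial sums over
  \<open>A\<close> and \<open>B\<close>, it lies on the segment from \<open>m q\<close> to \<open>(m - 1) p + q\<close>.\<close>

lemma weighted_sum_in_convex:
  fixes e :: "'i \<Rightarrow> 'a::real_vector" and c :: "'i \<Rightarrow> real"
  assumes C: "convex C" and fin: "finite A" "finite B"
    and c: "\<And>i. i \<in> A \<union> B \<Longrightarrow> 0 \<le> c i"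
    and le: "sum c A \<le> m - 1" and total: "sum c A + sum c B = m"
    and B: "\<And>s. s \<in> B \<Longrightarrow> m *\<^sub>R e s \<in> C"
    and AB: "\<And>r s. r \<in> A \<Longrightarrow> s \<in> B \<Longrightarrow> (m - 1) *\<^sub>R e r + e s \<in> C"
  shows "(\<Sum>i\<in>A. c i *\<^sub>R e i) + (\<Sum>i\<in>B. c i *\<^sub>R e i) \<in> C"
proof -
  define a where "a = sum c A"
  define b where "b = sum c B"
  define q where "q = (\<Sum>i\<in>B. (c i / b) *\<^sub>R e i)"
  have a: "0 \<le> a" unfolding a_def using c by (intro sum_nonneg) auto
  \<comment> \<open>The bound on the mass of \<open>A\<close> leaves mass at least 1 on
    \<open>B\<close>, so normalising by \<open>b\<close> is safe; \<open>a\<close> may vanish and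
    needs a case distinction.\<close>
  have b: "1 \<le> b" "b = m - a" using le total by (auto simp: a_def b_def)
  have q: "(\<Sum>i\<in>B. c i *\<^sub>R e i) = b *\<^sub>R q"
    using b(1) by (simp add: q_def scaleR_right.sum)
  have wB: "\<And>i. i \<in> B \<Longrightarrow> 0 \<le> c i / b" "(\<Sum>i\<in>B. c i / b) = 1"
    using b(1) c by (auto simp: sum_divide_distrib[symmetric] b_def)
  have mq: "m *\<^sub>R q \<in> C"
    using scaled_sum_in_convex[OF C fin(2) wB, of m e 0] B by (simp add: q_def)
  show ?thesis
  proof (cases "a = 0")
    case True
    then have "\<And>i. i \<in> A \<Longrightarrow> c i = 0"
      using c fin by (simp add: a_def sum_nonneg_eq_0_iff)
    then show ?thesis using q mq True b by simp
  next
    case False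
    then have a_pos: "0 < a" "a \<le> m - 1" using a le by (auto simp: a_def)
    define p where "p = (\<Sum>i\<in>A. (c i / a) *\<^sub>R e i)"
    have p: "(\<Sum>i\<in>A. c i *\<^sub>R e i) = a *\<^sub>R p"
      using a_pos by (simp add: p_def scaleR_right.sum)
    have wA: "\<And>i. i \<in> A \<Longrightarrow> 0 \<le> c i / a" "(\<Sum>i\<in>A. c i / a) = 1"
      using a_pos c by (auto simp: sum_divide_distrib[symmetric] a_def)
    \<comment> \<open>The average is taken over \<open>B\<close> first, for fixed \<open>r\<close>,
      and over \<open>A\<close> afterwards.\<close>
    have "(m - 1) *\<^sub>R e r + q \<in> C" if "r \<in> A" for r
      using scaled_sum_in_convex[OF C fin(2) wB, of 1 e "(m - 1) *\<^sub>R e r"] AB[OF that]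
      by (simp add: q_def add.commute)
    then have pq: "(m - 1) *\<^sub>R p + q \<in> C"
      using scaled_sum_in_convex[OF C fin(1) wA, of "m - 1" e q] by (simp add: p_def)
    \<comment> \<open>Chosen to give \<open>p\<close> the coefficient \<open>a\<close>; the
      coefficient of \<open>q\<close> then becomes \<open>m - a = b\<close>.\<close>
    define t where "t = a / (m - 1)"
    have t: "0 \<le> t" "t \<le> 1" "t * (m - 1) = a" using a_pos by (auto simp: t_def)
    have "(1 - t) *\<^sub>R (m *\<^sub>R q) + t *\<^sub>R ((m - 1) *\<^sub>R p + q) \<in> C"
      by (rule convexD_alt[OF C mq pq t(1,2)])
    also have "(1 - t) *\<^sub>R (m *\<^sub>R q) + t *\<^sub>R ((m - 1) *\<^sub>R p + q)
        = (t * (m - 1)) *\<^sub>R p + (m - t * (m - 1)) *\<^sub>R q"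
      by (simp add: algebra_simps)
    finally show ?thesis using p q t b by simp
  qed
qed

text \<open>If \<open>x\<close> were inside a segment of \<open>S\<close>, then \<open>f x\<close>
  would be a weighted mean of two values not above it. Both endpoints would then be maximizers,
  hence equal to \<open>x\<close> and to each other.\<close>

lemma extreme_point_of_unique_maximizer:
  fixes f :: "'a::real_vector \<Rightarrow> real"
  assumes "linear f" "x \<in> S"
    and le: "\<And>y. y \<in> S \<Longrightarrow> f y \<le> f x"
    and uniq: "\<And>y. y \<in> S \<Longrightarrow> f y = f x \<Longrightarrow> y = x"
  shows "x extreme_point_of S"
  unfolding extreme_point_of_def
proof (intro conjI ballI notI)
  fix a b assume ab: "a \<in> S" "b \<in> S" and "x \<in> open_segment a b"
  then obtain u where u: "a \<noteq> b" "0 < u" "u < 1" and x: "x = (1 - u) *\<^sub>R a + u *\<^sub>R b"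
    by (auto simp: in_segment)
  have "f x = (1 - u) * f a + u * f b"
    using assms(1) by (simp add: x linear_add linear_scale)
  then have "(1 - u) * (f x - f a) + u * (f x - f b) = 0" by (simp add: algebra_simps)
  moreover have "0 \<le> (1 - u) * (f x - f a)" "0 \<le> u * (f x - f b)"
    using u le ab by auto
  ultimately have "(1 - u) * (f x - f a) = 0" "u * (f x - f b) = 0" by linarith+
  then have "f a = f x" "f b = f x" using u by auto
  then show False using uniq ab u(1) by metis
qed (fact assms(2))

section \<open>The degree enumerator polytope\<close>

context
  fixes n :: nat and ix :: "nat \<Rightarrow> 'n::finite"
  assumes bij: "bij_betw ix {..<n} UNIV"
begin

section \<open>Coordinates of vectors under the numbering \<open>ix\<close>\<close>

lemma unit_vec_nth:
  assumes "i < n" "j < n"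
  shows "unit_vec ix i $ ix j = (if i = j then 1 else 0)"
  using bij assms by (auto simp: unit_vec_def axis_def bij_betw_def inj_on_def)

lemma vec_eq_iff_ix:
  fixes x y :: "real ^ 'n"
  shows "x = y \<longleftrightarrow> (\<forall>j<n. x $ ix j = y $ ix j)"
proof -
  have "(UNIV :: 'n set) = ix ` {..<n}" using bij by (simp add: bij_betw_def)
  then have "(\<forall>k. x $ k = y $ k) \<longleftrightarrow> (\<forall>j<n. x $ ix j = y $ ix j)"
    by (metis UNIV_I imageE lessThan_iff)
  then show ?thesis by (simp add: vec_eq_iff)
qed

lemma degree_enumerator_nth:
  assumes "j < n"
  shows "degree_enumerator n ix E $ ix j = real (num_of_degree n E j)"
proof -
  have "degree_enumerator n ix E $ ix j
      = (\<Sum>i<n. real (num_of_degree n E i) * (if i = j then 1 else 0))"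
    unfolding degree_enumerator_def using assms by (simp add: unit_vec_nth)
  also have "\<dots> = (\<Sum>i<n. if i = j then real (num_of_degree n E i) else 0)"
    by (intro sum.cong) auto
  finally show ?thesis using assms by simp
qed

lemma regular_vec_nth:
  assumes "r < n" "j < n"
  shows "regular_vec n ix r $ ix j = (if j = r then real n else 0)"
  using assms by (simp add: regular_vec_def unit_vec_nth)

lemma near_regular_vec_nth:
  assumes "r < n" "s < n" "j < n"
  shows "near_regular_vec n ix r s $ ix j
    = (if j = r then real (n - 1) else 0) + (if j = s then 1 else 0)"
  using assms by (simp add: near_regular_vec_def unit_vec_nth)

lemma degree_enumerator_regular_edges:
  assumes "r < n" "even n \<or> even r"
  shows "degree_enumerator n ix (regular_edges n r) = regular_vec n ix r"
proof -
  have "{v \<in> {..<n}. vertex_degree (regular_edges n r) v = j} = (if j = r then {..<n} else {})" for j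
    using vertex_degree_regular_edges[OF assms] by auto
  then show ?thesis
    using assms by (simp add: vec_eq_iff_ix degree_enumerator_nth regular_vec_nth num_of_degree_def)
qed

lemma degree_enumerator_near_regular_edges:
  assumes "odd n" "odd r" "r < n - 1" "even s" "s \<le> n - 1"
  shows "degree_enumerator n ix (near_regular_edges n r s) = near_regular_vec n ix r s"
proof -
  let ?d = "vertex_degree (near_regular_edges n r s)"
  have "{..<n} = insert (n - 1) {..<n - 1}" using assms by auto
  then have "{v \<in> {..<n}. ?d v = j} = {v \<in> insert (n - 1) {..<n - 1}. ?d v = j}" for j by simp
  also have "\<dots> j = (if j = r then {..<n - 1} else {}) \<union> (if j = s then {n - 1} else {})" for j
    using vertex_degree_near_regular_edges[OF assms]
      vertex_degree_near_regular_edges_last[OF assms] by auto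
  \<comment> \<open>As \<open>r\<close> is odd and \<open>s\<close> is even, at most one of the two
    sets is nonempty for a given \<open>j\<close>.\<close>
  finally have "num_of_degree n (near_regular_edges n r s) j
      = (if j = r then n - 1 else 0) + (if j = s then 1 else 0)" for j
    using assms(2,4) by (auto simp: num_of_degree_def)
  then show ?thesis
    using assms by (simp add: vec_eq_iff_ix degree_enumerator_nth near_regular_vec_nth)
qed

section \<open>The polytope as the hull of the claimed vertices\<close>

abbreviation "enumerators \<equiv> {degree_enumerator n ix E | E. simple_graph n E}"

text \<open>One set serves both parities: for even \<open>n\<close> the first family runs over all
  \<open>r < n\<close> and the second is empty.\<close>

definition graph_vertices :: "(real ^ 'n) set" where
  "graph_vertices =
     {regular_vec n ix r | r. r < n \<and> (even n \<or> even r)}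
     \<union> {near_regular_vec n ix r s | r s. odd n \<and> odd r \<and> r < n - 1 \<and> even s \<and> s \<le> n - 1}"

lemma graph_vertices_subset_enumerators: "graph_vertices \<subseteq> enumerators"
proof
  fix x assume "x \<in> graph_vertices"
  then consider r where "x = regular_vec n ix r" "r < n" "even n \<or> even r"
    | r s where "x = near_regular_vec n ix r s" "odd n" "odd r" "r < n - 1" "even s" "s \<le> n - 1"
    unfolding graph_vertices_def by blast
  then show "x \<in> enumerators"
  proof cases
    case (1 r)
    then show ?thesis
      using simple_graph_regular_edges[OF 1(2,3)] degree_enumerator_regular_edges[OF 1(2,3)]
      by (metis (mono_tags, lifting) mem_Collect_eq)
  next
    case (2 r s)
    then show ?thesis
      using simple_graph_near_regular_edges[OF 2(2-)] degree_enumerator_near_regular_edges[OF 2(2-)]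
      by (metis (mono_tags, lifting) mem_Collect_eq)
  qed
qed

text \<open>An instance of \<open>weighted_sum_in_convex\<close> with total mass \<open>n\<close>:
  \<open>A\<close> collects the odd degrees if \<open>n\<close> is odd and is empty otherwise, and
  the handshake bound limits its mass to \<open>n - 1\<close>.\<close>

lemma enumerators_subset_hull: "enumerators \<subseteq> convex hull graph_vertices"
proof clarify
  fix E assume E: "simple_graph n E"
  let ?c = "\<lambda>i. real (num_of_degree n E i)"
  define A where "A = {i. i < n \<and> odd n \<and> odd i}"
  define B where "B = {i. i < n \<and> (even n \<or> even i)}"
  \<comment> \<open>Polymorphic in the values, since it splits the sum of coefficients as well as
    the sum of vectors.\<close>
  have split: "sum g {..<n} = sum g A + sum g B" for g :: "nat \<Rightarrow> 'b::comm_monoid_add"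
    by (subst sum.union_disjoint[symmetric]) (auto simp: A_def B_def intro!: arg_cong2[of _ _ _ _ sum])
  have "(\<Sum>i\<in>A. ?c i *\<^sub>R unit_vec ix i) + (\<Sum>i\<in>B. ?c i *\<^sub>R unit_vec ix i)
      \<in> convex hull graph_vertices"
  proof (cases "n = 0")
    case True
    \<comment> \<open>An index type is nonempty, so \<open>n = 0\<close> contradicts the
      bijection.\<close>
    then show ?thesis using bij by (simp add: bij_betw_def)
  next
    case False
    show ?thesis
    proof (rule weighted_sum_in_convex[where m = "real n"])
      have "(\<Sum>i\<in>A. num_of_degree n E i) < n"
        using sum_num_of_odd_degree_less[OF E] False by (cases "odd n") (auto simp: A_def)
      then show "sum ?c A \<le> real n - 1"
        by (simp flip: of_nat_sum)
      have "sum ?c {..<n} = real n"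
        using sum_num_of_degree[OF E] by (simp flip: of_nat_sum)
      then show "sum ?c A + sum ?c B = real n" by (simp add: split)
    next
      fix s assume "s \<in> B"
      then have "regular_vec n ix s \<in> graph_vertices"
        by (auto simp: B_def graph_vertices_def)
      then show "real n *\<^sub>R unit_vec ix s \<in> convex hull graph_vertices"
        by (simp add: regular_vec_def hull_inc)
    next
      fix r s assume rs: "r \<in> A" "s \<in> B"
      \<comment> \<open>The strict bound comes from parity: \<open>r\<close> is odd while
        \<open>n - 1\<close> is even.\<close>
      then have "r < n - 1" "even s" "s \<le> n - 1" "odd r" "odd n"
        by (auto simp: A_def B_def intro: le_neq_trans)
      then have "near_regular_vec n ix r s \<in> graph_vertices"
        by (auto simp: graph_vertices_def)
      then show "(real n - 1) *\<^sub>R unit_vec ix r + unit_vec ix s \<in> convex hull graph_vertices"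
        using False by (simp add: near_regular_vec_def hull_inc of_nat_diff)
    qed (auto simp: A_def B_def)
  qed
  then show "degree_enumerator n ix E \<in> convex hull graph_vertices"
    by (simp add: degree_enumerator_def split)
qed

lemma degree_enumerator_polytope_eq:
  "degree_enumerator_polytope n ix = convex hull graph_vertices"
  unfolding degree_enumerator_polytope_def
  by (intro hull_eq subset_antisym hull_minimal enumerators_subset_hull convex_convex_hull
      hull_mono graph_vertices_subset_enumerators)

section \<open>Valid inequalities for the polytope\<close>

text \<open>These linear conditions cut out a convex set that contains every enumerator, hence also
  their convex hull.\<close>

lemma polytope_bounds:
  assumes "x \<in> degree_enumerator_polytope n ix"
  shows "j < n \<Longrightarrow> 0 \<le> x $ ix j"
    and "(\<Sum>j<n. x $ ix j) = n"
    and "odd n \<Longrightarrow> (\<Sum>j | j < n \<and> odd j. x $ ix j) \<le> n - 1"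
proof -
  let ?Q = "{x :: real ^ 'n. (\<forall>j<n. 0 \<le> x $ ix j) \<and> (\<Sum>j<n. x $ ix j) = n \<and>
    (odd n \<longrightarrow> (\<Sum>j | j < n \<and> odd j. x $ ix j) \<le> n - 1)}"
  have "convex ?Q"
    by (rule convexI)
      (auto simp: sum.distrib sum_distrib_left[symmetric] convex_bound_le
        distrib_right[symmetric])
  moreover have "enumerators \<subseteq> ?Q"
  proof clarify
    fix E assume E: "simple_graph n E"
    have "(\<Sum>j | j < n \<and> odd j. num_of_degree n E j) \<le> n - 1" if "odd n"
      using sum_num_of_odd_degree_less[OF E that] by simp
    then show "(\<forall>j<n. 0 \<le> degree_enumerator n ix E $ ix j) \<and>
        (\<Sum>j<n. degree_enumerator n ix E $ ix j) = n \<and>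
        (odd n \<longrightarrow> (\<Sum>j | j < n \<and> odd j. degree_enumerator n ix E $ ix j) \<le> n - 1)"
      using sum_num_of_degree[OF E] by (simp add: degree_enumerator_nth flip: of_nat_sum)
  qed
  ultimately have "x \<in> ?Q"
    using assms hull_minimal[of enumerators ?Q convex]
    unfolding degree_enumerator_polytope_def by blast
  then show "j < n \<Longrightarrow> 0 \<le> x $ ix j" "(\<Sum>j<n. x $ ix j) = n"
    "odd n \<Longrightarrow> (\<Sum>j | j < n \<and> odd j. x $ ix j) \<le> n - 1" by auto
qed

text \<open>The coordinates outside \<open>I\<close> are nonnegative and make up the rest of the
  total \<open>n\<close>. The inequality serves to bound a functional, the equality case to show
  that its maximizer is unique.\<close>

lemma polytope_sum_le:
  assumes x: "x \<in> degree_enumerator_polytope n ix" and I: "I \<subseteq> {..<n}"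
  shows "(\<Sum>j\<in>I. x $ ix j) \<le> n"
    and "(\<Sum>j\<in>I. x $ ix j) = n \<Longrightarrow> j < n \<Longrightarrow> j \<notin> I \<Longrightarrow> x $ ix j = 0"
proof -
  have nonneg: "0 \<le> x $ ix j" if "j \<in> {..<n} - I" for j
    using polytope_bounds(1)[OF x] that by simp
  have eq: "(\<Sum>j\<in>{..<n} - I. x $ ix j) + (\<Sum>j\<in>I. x $ ix j) = n"
    using sum.subset_diff[OF I, of "\<lambda>j. x $ ix j"] polytope_bounds(2)[OF x] by simp
  show "(\<Sum>j\<in>I. x $ ix j) \<le> n"
  proof -
    have "0 \<le> (\<Sum>j\<in>{..<n} - I. x $ ix j)" by (rule sum_nonneg) (rule nonneg)
    with eq show ?thesis by linarith
  qed
  show "x $ ix j = 0" if "(\<Sum>j\<in>I. x $ ix j) = n" "j < n" "j \<notin> I"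
  proof -
    have "(\<Sum>j\<in>{..<n} - I. x $ ix j) = 0" using eq that(1) by simp
    then have "\<forall>j\<in>{..<n} - I. x $ ix j = 0"
      by (subst (asm) sum_nonneg_eq_0_iff) (use nonneg in blast)+
    then show ?thesis using that(2,3) by blast
  qed
qed

section \<open>The claimed vertices are extreme points\<close>

lemma extreme_point_regular_vec:
  assumes P: "regular_vec n ix r \<in> degree_enumerator_polytope n ix" and r: "r < n"
  shows "regular_vec n ix r extreme_point_of degree_enumerator_polytope n ix"
proof (rule extreme_point_of_unique_maximizer[where f = "\<lambda>x. x $ ix r"])
  fix y assume y: "y \<in> degree_enumerator_polytope n ix"
  have sub: "{r} \<subseteq> {..<n}" using r by simp
  show "y $ ix r \<le> regular_vec n ix r $ ix r"
    using polytope_sum_le(1)[OF y sub] r by (simp add: regular_vec_nth)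
  assume "y $ ix r = regular_vec n ix r $ ix r"
  then have eq: "y $ ix r = n" using r by (simp add: regular_vec_nth)
  have "y $ ix j = 0" if "j < n" "j \<noteq> r" for j
    by (rule polytope_sum_le(2)[OF y sub]) (use eq that in simp_all)
  then show "y = regular_vec n ix r"
    using eq r by (auto simp: vec_eq_iff_ix regular_vec_nth)
qed (simp_all add: linear_iff P)

text \<open>The functional is the sum of \<open>y\<^sub>r\<close>, at most \<open>n - 1\<close>
  because \<open>r\<close> is odd, and \<open>y\<^sub>r + y\<^sub>s\<close>, at most
  \<open>n\<close>. Attaining the maximum makes both bounds tight, which fixes all
  coordinates.\<close>

lemma extreme_point_near_regular_vec:
  assumes P: "near_regular_vec n ix r s \<in> degree_enumerator_polytope n ix"
    and n: "odd n" and r: "odd r" "r < n" and s: "even s" "s < n"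
  shows "near_regular_vec n ix r s extreme_point_of degree_enumerator_polytope n ix"
proof (rule extreme_point_of_unique_maximizer[where f = "\<lambda>x. 2 * x $ ix r + x $ ix s"])
  have "r \<noteq> s" using r s by auto
  note nth = near_regular_vec_nth[OF r(2) s(2)]
  fix y assume y: "y \<in> degree_enumerator_polytope n ix"
  have "y $ ix r \<le> (\<Sum>j | j < n \<and> odd j. y $ ix j)"
    using r polytope_bounds(1)[OF y] by (intro member_le_sum) auto
  then have le_r: "y $ ix r \<le> real (n - 1)"
    using polytope_bounds(3)[OF y n] by simp
  have sub: "{r, s} \<subseteq> {..<n}" using r s by simp
  have le_rs: "y $ ix r + y $ ix s \<le> n"
    using polytope_sum_le(1)[OF y sub] \<open>r \<noteq> s\<close> by simp
  have max: "2 * near_regular_vec n ix r s $ ix r + near_regular_vec n ix r s $ ix s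
      = real (n - 1) + real n"
    using r s \<open>r \<noteq> s\<close> by (simp add: nth of_nat_diff)
  show "2 * y $ ix r + y $ ix s
      \<le> 2 * near_regular_vec n ix r s $ ix r + near_regular_vec n ix r s $ ix s"
    unfolding max using le_r le_rs by simp
  assume "2 * y $ ix r + y $ ix s
      = 2 * near_regular_vec n ix r s $ ix r + near_regular_vec n ix r s $ ix s"
  then have eq: "y $ ix r = real (n - 1)" "y $ ix r + y $ ix s = n"
    unfolding max using le_r le_rs by linarith+
  \<comment> \<open>From \<open>r < n\<close> the number \<open>n\<close> is positive, so the
    truncated subtraction \<open>n - 1\<close> is exact.\<close>
  then have "y $ ix s = 1" using r by simp
  moreover have "y $ ix j = 0" if "j < n" "j \<noteq> r" "j \<noteq> s" for j
    by (rule polytope_sum_le(2)[OF y sub]) (use eq(2) that \<open>r \<noteq> s\<close> in simp_all)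
  ultimately show "y = near_regular_vec n ix r s"
    using eq(1) \<open>r \<noteq> s\<close> by (auto simp: vec_eq_iff_ix nth)
qed (simp_all add: linear_iff P algebra_simps)

text \<open>Extreme points of a convex hull belong to the generating set; the converse inclusion is
  given by the two extremality lemmas.\<close>

lemma polytope_vertices_eq:
  "polytope_vertices (degree_enumerator_polytope n ix) = graph_vertices"
proof (intro equalityI subsetI)
  fix x assume "x \<in> polytope_vertices (degree_enumerator_polytope n ix)"
  then show "x \<in> graph_vertices"
    unfolding polytope_vertices_def degree_enumerator_polytope_eq
    by (auto dest: extreme_point_of_convex_hull)
next
  fix x assume x: "x \<in> graph_vertices"
  then have "x \<in> degree_enumerator_polytope n ix"
    by (simp add: degree_enumerator_polytope_eq hull_inc)
  with x have "x extreme_point_of degree_enumerator_polytope n ix"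
    unfolding graph_vertices_def
    by (auto intro!: extreme_point_regular_vec extreme_point_near_regular_vec)
  then show "x \<in> polytope_vertices (degree_enumerator_polytope n ix)"
    by (simp add: polytope_vertices_def)
qed

section \<open>Counting the vertices\<close>

lemma inj_on_regular_vec: "inj_on (regular_vec n ix) {..<n}"
proof (rule inj_onI)
  fix r r' assume "r \<in> {..<n}" "r' \<in> {..<n}" "regular_vec n ix r = regular_vec n ix r'"
  then show "r = r'"
    using regular_vec_nth[of r r] regular_vec_nth[of r' r] by (auto split: if_splits)
qed

lemma card_graph_vertices_even:
  assumes "even n"
  shows "card graph_vertices = n"
proof -
  have "graph_vertices = regular_vec n ix ` {..<n}"
    using assms by (auto simp: graph_vertices_def)
  then show ?thesis using inj_on_regular_vec by (simp add: card_image)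
qed

text \<open>With \<open>n = 2 * m + 1\<close> there are \<open>m + 1\<close> even values and
  \<open>m\<close> admissible odd ones, so the count is \<open>(m + 1) + m * (m + 1)\<close>, the
  square of \<open>m + 1\<close>.\<close>

lemma card_graph_vertices_odd:
  assumes "odd n"
  shows "card graph_vertices = ((n + 1) div 2)\<^sup>2"
proof -
  obtain m where m: "n = 2 * m + 1" using assms by (auto elim: oddE)
  define X where "X = (\<lambda>i. 2 * i) ` {..m}"
  define Y where "Y = (\<lambda>i. 2 * i + 1) ` {..<m}"
  have X: "r \<in> X \<longleftrightarrow> r < n \<and> even r" for r
    by (auto simp: X_def m elim!: evenE)
  have Y: "r \<in> Y \<longleftrightarrow> r < n - 1 \<and> odd r" for r
    by (auto simp: Y_def m elim!: oddE)
  have card_X: "card X = m + 1" and card_Y: "card Y = m"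
    by (simp_all add: X_def Y_def card_image inj_on_def)
  have fin: "finite X" "finite Y" by (simp_all add: X_def Y_def)
  let ?f = "\<lambda>(r, s). near_regular_vec n ix r s"
  have V: "graph_vertices = regular_vec n ix ` X \<union> ?f ` (Y \<times> X)"
    using assms by (fastforce simp: graph_vertices_def X Y image_iff)
  have inj: "inj_on (regular_vec n ix) X"
    by (rule inj_on_subset[OF inj_on_regular_vec]) (auto simp: X)
  \<comment> \<open>The odd coordinates reveal \<open>r\<close> and the even ones reveal
    \<open>s\<close>, so the vector determines both parameters.\<close>
  have nth_r: "near_regular_vec n ix r s $ ix j = (if j = r then real (n - 1) else 0)"
    if "r \<in> Y" "s \<in> X" "j < n" "odd j" for r s j
    using that near_regular_vec_nth[of r s j] by (auto simp: X Y)
  have nth_s: "near_regular_vec n ix r s $ ix j = (if j = s then 1 else 0)"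
    if "r \<in> Y" "s \<in> X" "j < n" "even j" for r s j
    using that near_regular_vec_nth[of r s j] by (auto simp: X Y)
  have "r = r' \<and> s = s'"
    if "r \<in> Y" "r' \<in> Y" "s \<in> X" "s' \<in> X"
      and eq: "near_regular_vec n ix r s = near_regular_vec n ix r' s'" for r r' s s'
  proof
    have "r < n" "odd r" "r < n - 1" "s < n" "even s" using that by (auto simp: X Y)
    then have "real (n - 1) = (if r = r' then real (n - 1) else 0)" "0 < real (n - 1)"
      using nth_r[of r s r] nth_r[of r' s' r] that by auto
    then show "r = r'" by (metis less_irrefl)
    have "(1 :: real) = (if s = s' then 1 else 0)"
      using nth_s[of r s s] nth_s[of r' s' s] that \<open>s < n\<close> \<open>even s\<close> by auto
    then show "s = s'" by (metis zero_neq_one)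
  qed
  then have inj': "inj_on ?f (Y \<times> X)"
    by (auto simp: inj_on_def)
  \<comment> \<open>The two families are separated by the odd coordinate \<open>r\<close>, which is
    zero in the first and positive in the second.\<close>
  have "regular_vec n ix q \<noteq> near_regular_vec n ix r s"
    if "q \<in> X" "r \<in> Y" "s \<in> X" for q r s
  proof -
    have "r < n" "odd r" "r < n - 1" "q < n" "even q" using that by (auto simp: X Y)
    then have "near_regular_vec n ix r s $ ix r > 0" "regular_vec n ix q $ ix r = 0"
      using nth_r[of r s r] regular_vec_nth[of q r] that by auto
    then show ?thesis by auto
  qed
  then have "regular_vec n ix ` X \<inter> ?f ` (Y \<times> X) = {}" by auto
  then have "card graph_vertices = card X + card Y * card X"
    unfolding V using fin inj inj'
    by (simp add: card_Un_disjoint card_image card_cartesian_product)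
  then show ?thesis using card_X card_Y by (simp add: m power2_eq_square)
qed

end

theorem theorem2p1:
  fixes n :: nat and ix :: "nat \<Rightarrow> 'n::finite"
  assumes "n \<ge> 1"
    and "CARD('n) = n"
    and "bij_betw ix {..<n} (UNIV :: 'n set)"
  shows
    "(even n \<longrightarrow>
        polytope_vertices (degree_enumerator_polytope n ix)
          = {regular_vec n ix r | r. r \<le> n - 1}
      \<and> (\<forall>r \<le> n - 1. simple_graph n (regular_edges n r)
            \<and> regular_vec n ix r = degree_enumerator n ix (regular_edges n r))
      \<and> card (polytope_vertices (degree_enumerator_polytope n ix)) = n)
   \<and> (odd n \<longrightarrow>
        polytope_vertices (degree_enumerator_polytope n ix)
          = {regular_vec n ix r | r. even r \<and> r \<le> n - 1}
            \<union> {near_regular_vec n ix r s | r s.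
                 odd r \<and> 0 < r \<and> r < n - 1 \<and> even s \<and> s \<le> n - 1}
      \<and> (\<forall>r. even r \<and> r \<le> n - 1 \<longrightarrow>
            simple_graph n (regular_edges n r)
            \<and> regular_vec n ix r = degree_enumerator n ix (regular_edges n r))
      \<and> (\<forall>r s. odd r \<and> 0 < r \<and> r < n - 1 \<and> even s \<and> s \<le> n - 1 \<longrightarrow>
            simple_graph n (near_regular_edges n r s)
            \<and> near_regular_vec n ix r s = degree_enumerator n ix (near_regular_edges n r s))
      \<and> card (polytope_vertices (degree_enumerator_polytope n ix)) = ((n + 1) div 2)\<^sup>2)"
proof (intro conjI impI allI)
  note bij = assms(3)
  note vertices = polytope_vertices_eq[OF bij]
  \<comment> \<open>Translates the range in the theorem into the one in
    \<open>graph_vertices\<close>; this relies on \<open>n\<close> being positive.\<close>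
  have less: "r \<le> n - 1 \<longleftrightarrow> r < n" for r using assms(1) by auto
  have pos: "odd r \<and> 0 < r \<and> Q \<longleftrightarrow> odd r \<and> Q" for r :: nat and Q
    using odd_pos by blast
  {
    assume n: "even n"
    show "polytope_vertices (degree_enumerator_polytope n ix) = {regular_vec n ix r | r. r \<le> n - 1}"
      unfolding vertices graph_vertices_def[OF bij] less using n by simp
    show "card (polytope_vertices (degree_enumerator_polytope n ix)) = n"
      using n by (simp add: vertices card_graph_vertices_even[OF bij])
    fix r assume "r \<le> n - 1"
    then have "r < n" using less by blast
    then show "simple_graph n (regular_edges n r)"
      "regular_vec n ix r = degree_enumerator n ix (regular_edges n r)"
      using n by (simp_all add: simple_graph_regular_edges degree_enumerator_regular_edges[OF bij])
  }
  {
    assume n: "odd n"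
    show "polytope_vertices (degree_enumerator_polytope n ix)
          = {regular_vec n ix r | r. even r \<and> r \<le> n - 1}
            \<union> {near_regular_vec n ix r s | r s.
                 odd r \<and> 0 < r \<and> r < n - 1 \<and> even s \<and> s \<le> n - 1}"
      unfolding vertices graph_vertices_def[OF bij] less pos using n by (simp add: conj_commute)
    show "card (polytope_vertices (degree_enumerator_polytope n ix)) = ((n + 1) div 2)\<^sup>2"
      using n by (simp add: vertices card_graph_vertices_odd[OF bij])
    {
      fix r assume "even r \<and> r \<le> n - 1"
      then have "even r" "r < n" using less by blast+
      then show "simple_graph n (regular_edges n r)"
        "regular_vec n ix r = degree_enumerator n ix (regular_edges n r)"
        by (simp_all add: simple_graph_regular_edges degree_enumerator_regular_edges[OF bij])
    }
    {
      fix r s assume "odd r \<and> 0 < r \<and> r < n - 1 \<and> even s \<and> s \<le> n - 1"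
      then show "simple_graph n (near_regular_edges n r s)"
        "near_regular_vec n ix r s = degree_enumerator n ix (near_regular_edges n r s)"
        using n by (simp_all add: simple_graph_near_regular_edges
            degree_enumerator_near_regular_edges[OF bij])
    }
  }
qed

end
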